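(* Consider the binary delegation problem described in the context, and let $\mu_p\in[1/2,1]$ be the principal's prior probability of state $r$. Then the principal's problem $$\max_{\mu\in[0,1]}\ \left\{\mu_p\,\pi^*_\mu(R|r)+(1-\mu_p)\,\pi^*_\mu(L|l)\right\}$$ is solved by $$\mu^*(\mu_p)=\frac{\sqrt{\mu_p}}{\sqrt{\mu_p}+\sqrt{1-\mu_p}} .$$ Therefore, if $\mu_p\in(1/2,1)$, the principal optimally delegates to an agent with prior belief in $(1/2,\mu_p)$.
   Context: Binary delegation problem. States $\Omega=\{l,r\}$, actions $\mathcal A=\{L,R\}$, payoff $u(L,l)=u(R,r)=1$, $u(L,r)=u(R,l)=0$. A belief is represented by the probability $\mu\in[0,1]$ it assigns to $r$. There is one agent for each prior $\mu\in[0,1]$. Agent's problem. An agent with prior $\mu$ chooses a signal structure $\phi:\Omega\to\Delta(\mathcal S)$ (with $\mathcal S$ a fixed, sufficiently rich signal space) and a choice rule $\sigma:\mathcal S\to\Delta(\mathcal A)$ to maximize $$\sum_{\omega}\mu(\omega)\sum_{s,a}\phi(s|\omega)\sigma(a|s)u(a,\omega)-c(\phi,\mu),$$ where $\mu(r)=\mu$, $\mu(l)=1-\mu$. The information cost is uniformly posterior separable: $c(\phi,\mu)=\lambda\big(\mathbb E[\hat c(\eta(s))\mid\phi]-\hat c(\mu)\big)$, $\lambda>0$, where $\eta(s)\in[0,1]$ is the posterior probability of $r$ after signal $s$ (Bayes' rule from $\mu$ and $\phi$) and the expectation is over $s$ under the agent's prior. Here $\hat c:[0,1]\to\mathbb R\cup\{+\infty\}$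 is finite, strictly convex and twice continuously differentiable on $(0,1)$, symmetric ($\hat c(x)=\hat c(1-x)$), satisfies the Inada condition $\lim_{x\to0+}\hat c'(x)=-\infty$, and $\hat c(0)=\hat c(1)=\lim_{x\to 0+}\hat c(x)$. (An example is $\hat c(x)=x\ln x+(1-x)\ln(1-x)$.) Agents with degenerate priors $\mu=0$, $\mu=1$ acquire no information and take $L$, respectively $R$, in both states. $\pi^*_\mu(a|\omega)=\sum_s\phi^*_\mu(s|\omega)\sigma^*_\mu(a|s)$ denotes the probability that action $a$ is taken in state $\omega$ under the optimal strategy $(\phi^*_\mu,\sigma^*_\mu)$ of the agent with prior $\mu$. The principal does not bear the information cost and evaluates states with her own prior $\mu_p$. *)

theory Defs
  imports "HOL-Probability.Probability"
begin

datatype state = StateL | StateR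
datatype action = ActL | ActR

fun payoff :: "action \<Rightarrow> state \<Rightarrow> real" where
  "payoff ActL StateL = 1"
| "payoff ActR StateR = 1"
| "payoff ActL StateR = 0"
| "payoff ActR StateL = 0"

(* A belief is the probability of StateR; prior m is meaningful for 0 \<le> m \<le> 1. *)
definition prior :: "real \<Rightarrow> state pmf" where
  "prior m = map_pmf (\<lambda>b. if b then StateR else StateL) (bernoulli_pmf m)"

(* The signal structure \<phi> paired with the choice rule \<sigma>.  The signal space is the type 's. *)
type_synonym 's strategy = "(state \<Rightarrow> 's pmf) \<times> ('s \<Rightarrow> action pmf)"

definition signal_dist :: "real \<Rightarrow> (state \<Rightarrow> 's pmf) \<Rightarrow> 's pmf" where
  "signal_dist m \<phi> = bind_pmf (prior m) \<phi>"

(* Bayes' rule.  On signals of probability zero the value is the junk value 0, which does not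
   enter any expectation under signal_dist m \<phi>. *)
definition posterior :: "real \<Rightarrow> (state \<Rightarrow> 's pmf) \<Rightarrow> 's \<Rightarrow> real" where
  "posterior m \<phi> s = pmf (prior m) StateR * pmf (\<phi> StateR) s / pmf (signal_dist m \<phi>) s"

(* Expectation of an extended real function: integral of the positive part minus integral of
   the negative part.  It is applied only to functions that are bounded below, so the
   difference is never of the form \<infinity> - \<infinity>. *)
definition expectation_ereal :: "'s pmf \<Rightarrow> ('s \<Rightarrow> ereal) \<Rightarrow> ereal" where
  "expectation_ereal p f =
     enn2ereal (\<integral>\<^sup>+ s. e2ennreal (f s) \<partial>measure_pmf p)
   - enn2ereal (\<integral>\<^sup>+ s. e2ennreal (- f s) \<partial>measure_pmf p)"

definition info_cost ::
  "(real \<Rightarrow> ereal) \<Rightarrow> real \<Rightarrow> real \<Rightarrow> (state \<Rightarrow> 's pmf) \<Rightarrow> ereal" where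
  "info_cost c lam m \<phi> =
     ereal lam * (expectation_ereal (signal_dist m \<phi>) (\<lambda>s. c (posterior m \<phi> s)) - c m)"

definition expected_payoff :: "real \<Rightarrow> 's strategy \<Rightarrow> real" where
  "expected_payoff m st = (\<Sum>\<omega>\<in>{StateL, StateR}. pmf (prior m) \<omega> *
     measure_pmf.expectation (fst st \<omega>)
       (\<lambda>s. \<Sum>a\<in>{ActL, ActR}. pmf (snd st s) a * payoff a \<omega>))"

definition agent_objective ::
  "(real \<Rightarrow> ereal) \<Rightarrow> real \<Rightarrow> real \<Rightarrow> 's strategy \<Rightarrow> ereal" where
  "agent_objective c lam m st = ereal (expected_payoff m st) - info_cost c lam m (fst st)"

definition choice_prob :: "'s strategy \<Rightarrow> action \<Rightarrow> state \<Rightarrow> real" where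
  "choice_prob st a \<omega> = measure_pmf.expectation (fst st \<omega>) (\<lambda>s. pmf (snd st s) a)"

(* Optimal behaviour of the agent with prior m.  For the degenerate priors 0 and 1 it is fixed
   by convention: an uninformative signal structure, and always L, respectively R. *)
definition agent_optimal ::
  "(real \<Rightarrow> ereal) \<Rightarrow> real \<Rightarrow> real \<Rightarrow> 's strategy \<Rightarrow> bool" where
  "agent_optimal c lam m st \<longleftrightarrow>
     (if m = 0 then
        fst st StateL = fst st StateR \<and> (\<forall>\<omega>. choice_prob st ActL \<omega> = 1)
      else if m = 1 then
        fst st StateL = fst st StateR \<and> (\<forall>\<omega>. choice_prob st ActR \<omega> = 1)
      else is_arg_max (agent_objective c lam m) (\<lambda>_. True) st)"

definition optimal_profile ::
  "(real \<Rightarrow> ereal) \<Rightarrow> real \<Rightarrow> (real \<Rightarrow> 's strategy) \<Rightarrow> bool" where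
  "optimal_profile c lam prof \<longleftrightarrow> (\<forall>m\<in>{0..1}. agent_optimal c lam m (prof m))"

(* Only the values on the unit interval matter; the derivatives c' and c'' are those of the real-valued
   restriction to the open interval.  The limit at 0 is taken in the extended reals. *)
definition cost_potential :: "(real \<Rightarrow> ereal) \<Rightarrow> bool" where
  "cost_potential c \<longleftrightarrow>
     (\<forall>x\<in>{0..1}. c x \<noteq> - \<infinity>) \<and>
     (\<forall>x\<in>{0<..<1}. c x \<noteq> \<infinity>) \<and>
     (\<forall>x\<in>{0<..<1}. \<forall>y\<in>{0<..<1}. \<forall>t\<in>{0<..<1}. x \<noteq> y \<longrightarrow>
        c ((1 - t) * x + t * y) < ereal (1 - t) * c x + ereal t * c y) \<and>
     (\<exists>c' c''.
        (\<forall>x\<in>{0<..<1}. ((\<lambda>z. real_of_ereal (c z)) has_real_derivative c' x) (at x)) \<and>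
        (\<forall>x\<in>{0<..<1}. (c' has_real_derivative c'' x) (at x)) \<and>
        continuous_on {0<..<1} c'' \<and>
        filterlim c' at_bot (at_right 0)) \<and>
     (\<forall>x\<in>{0..1}. c x = c (1 - x)) \<and>
     (c \<longlongrightarrow> c 0) (at_right 0) \<and> c 1 = c 0"

definition principal_value :: "real \<Rightarrow> 's strategy \<Rightarrow> real" where
  "principal_value mp st =
     mp * choice_prob st ActR StateR + (1 - mp) * choice_prob st ActL StateL"

definition solves_principal ::
  "real \<Rightarrow> (real \<Rightarrow> 's strategy) \<Rightarrow> real \<Rightarrow> bool" where
  "solves_principal mp prof mu \<longleftrightarrow>
     is_arg_max (\<lambda>m. principal_value mp (prof m)) (\<lambda>m. m \<in> {0..1}) mu"

definition mu_star :: "real \<Rightarrow> real" where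
  "mu_star mp = sqrt mp / (sqrt mp + sqrt (1 - mp))"

end

theory Submission
  imports Defs
begin

text \<open>
  A non-degenerate agent chooses a distribution of posteriors \<open>x\<close> with mean \<open>m\<close> to maximise the expectation of
  \<open>max x (1 - x) - lam * c x\<close>, so optimality is certified by a line that lies above this function.
  If \<open>lam * c' q = 1\<close>, the concave envelope is constant on \<open>[1 - q, q]\<close> and agrees with the function
  outside. An agent with a prior in \<open>[1 - q, q]\<close> therefore splits it into the posteriors \<open>1 - q\<close> and \<open>q\<close>,
  and every other agent learns nothing. Since any optimal strategy puts all its mass where the
  supporting line touches, the choice probabilities are unique, and the value of the principal at the prior \<open>m\<close> is a
  decreasing affine function of \<open>mp / k + (1 - mp) / (1 - k)\<close>, where \<open>k\<close> is \<open>m\<close> clamped to \<open>[1 - q, q]\<close>.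
  This convex function of \<open>k\<close> is minimal at \<open>mu_star mp\<close>, or at \<open>q\<close> when \<open>mu_star mp\<close> exceeds \<open>q\<close>.
\<close>

section \<open>Bayesian updating\<close>

lemma pmf_prior:
  assumes "m \<in> {0..1}"
  shows "pmf (prior m) StateR = m" "pmf (prior m) StateL = 1 - m"
proof -
  have "(\<lambda>b. if b then StateR else StateL) -` {StateR} = {True}"
    "(\<lambda>b. if b then StateR else StateL) -` {StateL} = {False}"
    by (auto split: if_splits)
  then show "pmf (prior m) StateR = m" "pmf (prior m) StateL = 1 - m"
    using assms by (simp_all add: prior_def pmf_map measure_pmf_single)
qed

lemma pmf_signal_dist:
  assumes "m \<in> {0..1}"
  shows "pmf (signal_dist m \<phi>) s = (1 - m) * pmf (\<phi> StateL) s + m * pmf (\<phi> StateR) s"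
  using assms by (simp add: signal_dist_def prior_def bind_map_pmf pmf_bind)

text \<open>Bayes' rule with the denominator cleared, so that it also holds at null signals: there
  both nonnegative summands of the denominator vanish, which makes the junk value of
  \<open>posterior\<close> harmless.\<close>

lemma posterior_weights:
  assumes "m \<in> {0..1}"
  shows "pmf (signal_dist m \<phi>) s * posterior m \<phi> s = m * pmf (\<phi> StateR) s"
    and "pmf (signal_dist m \<phi>) s * (1 - posterior m \<phi> s) = (1 - m) * pmf (\<phi> StateL) s"
proof -
  let ?p = "pmf (signal_dist m \<phi>) s"
  have sum: "?p = (1 - m) * pmf (\<phi> StateL) s + m * pmf (\<phi> StateR) s"
    using assms by (rule pmf_signal_dist)
  have "0 \<le> (1 - m) * pmf (\<phi> StateL) s" "0 \<le> m * pmf (\<phi> StateR) s"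
    using assms by auto
  then show *: "?p * posterior m \<phi> s = m * pmf (\<phi> StateR) s"
    using sum pmf_prior[OF assms]
    by (cases "?p = 0") (auto simp: posterior_def add_nonneg_eq_0_iff simp del: mult_eq_0_iff)
  show "?p * (1 - posterior m \<phi> s) = (1 - m) * pmf (\<phi> StateL) s"
    unfolding right_diff_distrib * using sum by simp
qed

lemma posterior_bounds:
  assumes "m \<in> {0..1}"
  shows "posterior m \<phi> s \<in> {0..1}"
proof -
  have "0 \<le> (1 - m) * pmf (\<phi> StateL) s" "0 \<le> m * pmf (\<phi> StateR) s"
    using assms by auto
  then show ?thesis
    using pmf_prior[OF assms]
    by (auto simp: posterior_def pmf_signal_dist[OF assms] intro!: divide_le_eq_1[THEN iffD2])
qed

lemma expectation_count_space:
  "measure_pmf.expectation p f = (\<integral>s. pmf p s * f s \<partial>count_space UNIV)" for f :: "'s \<Rightarrow> real"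
  by (subst measure_pmf_eq_density, subst integral_density) auto

text \<open>A change of measure: weighting by the prior turns expectations conditional on the state
  into expectations under the unconditional law of the signal, where the information cost is
  computed.\<close>

lemma expectation_posterior:
  fixes f :: "'s \<Rightarrow> real"
  assumes "m \<in> {0..1}"
  shows "m * measure_pmf.expectation (\<phi> StateR) f =
      measure_pmf.expectation (signal_dist m \<phi>) (\<lambda>s. posterior m \<phi> s * f s)"
    and "(1 - m) * measure_pmf.expectation (\<phi> StateL) f =
      measure_pmf.expectation (signal_dist m \<phi>) (\<lambda>s. (1 - posterior m \<phi> s) * f s)"
  using posterior_weights[OF assms, of \<phi>]
  by (simp_all only: expectation_count_space mult.assoc[symmetric] flip: integral_mult_right_zero)

lemma integrable_pmf_bounded:
  fixes f :: "'s \<Rightarrow> real"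
  assumes "\<And>s. s \<in> set_pmf p \<Longrightarrow> \<bar>f s\<bar> \<le> B"
  shows "integrable (measure_pmf p) f"
  using assms by (intro measure_pmf.integrable_const_bound[where B = B]) (auto simp: AE_measure_pmf_iff)

lemma pmf_action_sum: "pmf q ActL + pmf q ActR = 1" for q :: "action pmf"
proof -
  have "(UNIV :: action set) = {ActL, ActR}"
    using action.exhaust by auto
  then have "set_pmf q \<subseteq> {ActL, ActR}"
    by auto
  then show ?thesis
    using sum_pmf_eq_1[of "{ActL, ActR}" q] by simp
qed

lemma choice_prob_sum: "choice_prob st ActL \<omega> + choice_prob st ActR \<omega> = 1"
proof -
  have "choice_prob st ActL \<omega> + choice_prob st ActR \<omega>
      = measure_pmf.expectation (fst st \<omega>) (\<lambda>s. pmf (snd st s) ActL + pmf (snd st s) ActR)"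
    unfolding choice_prob_def
    by (intro Bochner_Integration.integral_add[symmetric] integrable_pmf_bounded[of _ _ 1])
      (auto simp: pmf_le_1)
  then show ?thesis
    by (simp add: pmf_action_sum)
qed

lemma posterior_integrable:
  assumes "m \<in> {0..1}" "\<And>s. \<bar>f s\<bar> \<le> 1"
  shows "integrable (measure_pmf (signal_dist m \<phi>)) (\<lambda>s. posterior m \<phi> s * f s)"
    and "integrable (measure_pmf (signal_dist m \<phi>)) (\<lambda>s. (1 - posterior m \<phi> s) * f s)"
  using posterior_bounds[OF assms(1), of \<phi>] assms(2)
  by (auto intro!: integrable_pmf_bounded[of _ _ 1] mult_le_one simp: abs_mult)

lemma expectation_posterior_eq_prior:
  assumes "m \<in> {0..1}"
  shows "measure_pmf.expectation (signal_dist m \<phi>) (posterior m \<phi>) = m"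
  using expectation_posterior(1)[OF assms, of \<phi> "\<lambda>_. 1"] by simp

lemma expected_payoff_posterior:
  assumes "m \<in> {0..1}"
  shows "expected_payoff m st = measure_pmf.expectation (signal_dist m (fst st))
    (\<lambda>s. posterior m (fst st) s * pmf (snd st s) ActR + (1 - posterior m (fst st) s) * pmf (snd st s) ActL)"
proof -
  have "expected_payoff m st = (1 - m) * choice_prob st ActL StateL + m * choice_prob st ActR StateR"
    by (simp add: expected_payoff_def choice_prob_def pmf_prior[OF assms])
  then show ?thesis
    by (simp add: choice_prob_def expectation_posterior[OF assms] posterior_integrable[OF assms] pmf_le_1)
qed

section \<open>Expectations of extended real functions\<close>

lemma e2ennreal_ereal: "e2ennreal (ereal x) = ennreal x"
  by (cases "0 \<le> x")
    (metis e2ennreal_enn2ereal enn2ereal_ennreal, simp add: e2ennreal_neg ennreal_neg)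

lemma expectation_ereal_eq:
  assumes "\<And>s. s \<in> set_pmf p \<Longrightarrow> f s = ereal (g s)" "integrable (measure_pmf p) g"
  shows "expectation_ereal p f = ereal (measure_pmf.expectation p g)"
proof -
  have pos: "(\<integral>\<^sup>+ s. e2ennreal (f s) \<partial>measure_pmf p) = (\<integral>\<^sup>+ s. ennreal (g s) \<partial>measure_pmf p)"
    and neg: "(\<integral>\<^sup>+ s. e2ennreal (- f s) \<partial>measure_pmf p) = (\<integral>\<^sup>+ s. ennreal (- g s) \<partial>measure_pmf p)"
    using assms(1) by (auto intro!: nn_integral_cong_AE simp: AE_measure_pmf_iff e2ennreal_ereal)
  obtain r q where "0 \<le> r" "0 \<le> q" "(\<integral>\<^sup>+ s. ennreal (g s) \<partial>measure_pmf p) = ennreal r"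
    "(\<integral>\<^sup>+ s. ennreal (- g s) \<partial>measure_pmf p) = ennreal q" "integral\<^sup>L (measure_pmf p) g = r - q"
    using integrableE[OF assms(2)] by metis
  then show ?thesis
    unfolding expectation_ereal_def pos neg by (simp add: enn2ereal_ennreal)
qed

text \<open>The lower bound keeps the integral of the negative part finite. If that of the positive
  part were finite too, \<open>f\<close> would be finite on the support and integrable.\<close>

lemma expectation_ereal_infinite:
  assumes bound: "\<And>s. s \<in> set_pmf p \<Longrightarrow> ereal b \<le> f s"
    and "\<not> ((\<forall>s\<in>set_pmf p. f s \<noteq> \<infinity>) \<and> integrable (measure_pmf p) (\<lambda>s. real_of_ereal (f s)))"
  shows "expectation_ereal p f = \<infinity>"
proof -
  have neg_le: "(\<integral>\<^sup>+ s. e2ennreal (- f s) \<partial>measure_pmf p) \<le> (\<integral>\<^sup>+ s. ennreal (- b) \<partial>measure_pmf p)"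
  proof (intro nn_integral_mono_AE, unfold AE_measure_pmf_iff, intro ballI)
    fix s assume "s \<in> set_pmf p"
    then have "- f s \<le> ereal (- b)"
      using bound ereal_minus_le_minus uminus_ereal.simps(1) by metis
    then show "e2ennreal (- f s) \<le> ennreal (- b)"
      by (metis e2ennreal_mono e2ennreal_ereal)
  qed
  then have neg: "(\<integral>\<^sup>+ s. e2ennreal (- f s) \<partial>measure_pmf p) \<noteq> \<infinity>"
    by (auto simp: top_unique)
  have pos: "(\<integral>\<^sup>+ s. e2ennreal (f s) \<partial>measure_pmf p) = \<infinity>"
  proof (rule ccontr)
    assume fin: "(\<integral>\<^sup>+ s. e2ennreal (f s) \<partial>measure_pmf p) \<noteq> \<infinity>"
    then have "AE s in measure_pmf p. e2ennreal (f s) \<noteq> \<infinity>"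
      by (intro nn_integral_PInf_AE) auto
    then have finf: "\<forall>s\<in>set_pmf p. f s \<noteq> \<infinity>"
      by (auto simp: AE_measure_pmf_iff)
    have real: "f s = ereal (real_of_ereal (f s))" if "s \<in> set_pmf p" for s
      using bound[OF that] finf that by (cases "f s") auto
    have "(\<integral>\<^sup>+ s. ennreal (real_of_ereal (f s)) \<partial>measure_pmf p) = (\<integral>\<^sup>+ s. e2ennreal (f s) \<partial>measure_pmf p)"
      "(\<integral>\<^sup>+ s. ennreal (- real_of_ereal (f s)) \<partial>measure_pmf p) = (\<integral>\<^sup>+ s. e2ennreal (- f s) \<partial>measure_pmf p)"
      using real by (auto intro!: nn_integral_cong_AE simp: AE_measure_pmf_iff)
        (metis e2ennreal_ereal uminus_ereal.simps(1))+
    then have "integrable (measure_pmf p) (\<lambda>s. real_of_ereal (f s))"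
      using fin neg by (simp add: real_integrable_def)
    then show False
      using assms(2) finf by blast
  qed
  show ?thesis
    using neg unfolding expectation_ereal_def pos
    by (cases "\<integral>\<^sup>+ s. e2ennreal (- f s) \<partial>measure_pmf p") (auto simp: enn2ereal_ennreal)
qed

section \<open>Tangents of the cost potential\<close>

locale delegation =
  fixes c :: "real \<Rightarrow> ereal" and lam :: real
  assumes potential: "cost_potential c" and lam_pos: "0 < lam"
begin

definition h :: "real \<Rightarrow> real" where
  "h x = real_of_ereal (c x)"

text \<open>\<open>deriv\<close> avoids carrying the existential witness \<open>c'\<close> of
  \<open>cost_potential\<close>; the two agree on the open interval.\<close>

definition d :: "real \<Rightarrow> real" where
  "d = deriv h"

lemma potential_facts:
  shows c_neq_MInf: "x \<in> {0..1} \<Longrightarrow> c x \<noteq> - \<infinity>"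
    and c_neq_PInf: "x \<in> {0<..<1} \<Longrightarrow> c x \<noteq> \<infinity>"
    and c_sym: "x \<in> {0..1} \<Longrightarrow> c x = c (1 - x)"
    and c_tendsto_0: "(c \<longlongrightarrow> c 0) (at_right 0)"
    and c_strict_convex: "\<lbrakk>x \<in> {0<..<1}; y \<in> {0<..<1}; t \<in> {0<..<1}; x \<noteq> y\<rbrakk>
      \<Longrightarrow> c ((1 - t) * x + t * y) < ereal (1 - t) * c x + ereal t * c y"
  using potential unfolding cost_potential_def by blast+

lemma c_eq_h': "x \<in> {0..1} \<Longrightarrow> c x \<noteq> \<infinity> \<Longrightarrow> c x = ereal (h x)"
  using c_neq_MInf[of x] unfolding h_def by (cases "c x") auto

lemma c_eq_h: "x \<in> {0<..<1} \<Longrightarrow> c x = ereal (h x)"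
  using c_neq_PInf by (intro c_eq_h') auto

lemma h_sym: "x \<in> {0..1} \<Longrightarrow> h (1 - x) = h x"
  using c_sym[of x] by (simp add: h_def)

lemma h_derivative_facts:
  shows h_deriv: "x \<in> {0<..<1} \<Longrightarrow> (h has_real_derivative d x) (at x)"
    and d_cont: "continuous_on {0<..<1} d"
    and d_at_bot: "filterlim d at_bot (at_right 0)"
proof -
  obtain c' c'' where c': "\<forall>x\<in>{0<..<1}. (h has_real_derivative c' x) (at x)"
    and c'': "\<forall>x\<in>{0<..<1}. (c' has_real_derivative c'' x) (at x)"
    and lim: "filterlim c' at_bot (at_right 0)"
    using potential unfolding cost_potential_def h_def[abs_def] by blast
  have eq: "d x = c' x" if "x \<in> {0<..<1}" for x
    using c' that DERIV_imp_deriv unfolding d_def by blast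
  then show "x \<in> {0<..<1} \<Longrightarrow> (h has_real_derivative d x) (at x)"
    using c' by simp
  have "continuous_on {0<..<1} c'"
    using c'' by (meson DERIV_isCont continuous_at_imp_continuous_on)
  then show "continuous_on {0<..<1} d"
    using eq continuous_on_cong by metis
  have "eventually (\<lambda>x. c' x = d x) (at_right 0)"
    using eq by (auto simp: eventually_at_right_field intro!: exI[of _ 1])
  then show "filterlim d at_bot (at_right 0)"
    using lim filterlim_cong by fast
qed

text \<open>Differentiate the symmetry of \<open>h\<close>.\<close>

lemma d_sym:
  assumes "x \<in> {0<..<1}"
  shows "d (1 - x) = - d x"
proof -
  have "((\<lambda>y. h (1 - y)) has_real_derivative - d (1 - x)) (at x)"
  proof -
    have "((-) 1 has_real_derivative - 1) (at x)"
      by (auto intro!: derivative_eq_intros)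
    then show ?thesis
      using DERIV_chain2[of h "d (1 - x)" "(-) 1" x "- 1"] h_deriv[of "1 - x"] assms by simp
  qed
  then have "(h has_real_derivative - d (1 - x)) (at x)"
    by (rule has_field_derivative_transform_within_open[where S = "{0<..<1}"])
      (use assms h_sym in auto)
  then show ?thesis
    using h_deriv[OF assms] DERIV_unique by fastforce
qed

lemma h_strict_convex:
  assumes "x \<in> {0<..<1}" "y \<in> {0<..<1}" "t \<in> {0<..<1}" "x \<noteq> y"
  shows "h ((1 - t) * x + t * y) < (1 - t) * h x + t * h y"
proof -
  have "(1 - t) * x + t * y \<in> {0<..<1}"
    using convexD[of "{0<..<1::real}" x y "1 - t" t] assms by auto
  moreover have "c ((1 - t) * x + t * y) < ereal (1 - t) * c x + ereal t * c y"
    using assms by (rule c_strict_convex)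
  ultimately show ?thesis
    using assms by (simp add: c_eq_h)
qed

lemma h_above_tangent_interior:
  assumes "m \<in> {0<..<1}" "x \<in> {0<..<1}" "x \<noteq> m"
  shows "h m + d m * (x - m) < h x"
proof -
  have convex: "convex_on {0<..<1} h"
  proof (rule convex_on_linorderI)
    fix t x y :: real
    assume "0 < t" "t < 1" "x \<in> {0<..<1}" "y \<in> {0<..<1}" "x < y"
    then show "h ((1 - t) *\<^sub>R x + t *\<^sub>R y) \<le> (1 - t) * h x + t * h y"
      using h_strict_convex[of x y t] by simp
  qed simp
  have tangent: "d m * (y - m) \<le> h y - h m" if "y \<in> {0<..<1}" for y
  proof (rule convex_on_imp_above_tangent[OF convex])
    show "m \<in> interior {0<..<1}"
      using assms(1) by (simp add: interior_open)
    show "(h has_real_derivative d m) (at m within {0<..<1})"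
      using h_deriv[OF assms(1)] by (rule has_field_derivative_at_within)
  qed (use that in auto)
  \<comment> \<open>Strictness comes from the midpoint of \<open>m\<close> and \<open>x\<close>:
    \<open>h\<close> lies strictly below its chord there, while the weak tangent bound still
    holds.\<close>
  have "h ((1 - 1/2) * m + 1/2 * x) < (1 - 1/2) * h m + 1/2 * h x"
    using assms by (intro h_strict_convex) auto
  moreover have "d m * ((1 - 1/2) * m + 1/2 * x - m) \<le> h ((1 - 1/2) * m + 1/2 * x) - h m"
    using assms by (intro tangent) auto
  ultimately show ?thesis
    by (simp add: field_simps)
qed

lemma d_strict_mono:
  assumes "x \<in> {0<..<1}" "y \<in> {0<..<1}" "x < y"
  shows "d x < d y"
proof -
  have "h x + d x * (y - x) < h y" "h y + d y * (x - y) < h x"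
    using assms by (auto intro!: h_above_tangent_interior)
  then have "(d x - d y) * (y - x) < 0"
    by (simp add: algebra_simps)
  then show ?thesis
    using assms by (simp add: mult_less_0_iff)
qed

text \<open>The limit at 0 preserves only weak inequalities. Hence it is taken for the tangent at
  \<open>m / 2\<close>, whose value at 0 strictly exceeds that of the tangent at
  \<open>m\<close>.\<close>

lemma h_above_tangent_0:
  assumes m: "m \<in> {0<..<1}" and "c 0 \<noteq> \<infinity>"
  shows "h m - d m * m < h 0"
proof -
  define k where "k = m / 2"
  have k: "k \<in> {0<..<1}" "k < m"
    using m by (auto simp: k_def)
  have "(c \<longlongrightarrow> ereal (h 0)) (at_right 0)"
    using c_tendsto_0 c_eq_h'[of 0] assms(2) by simp
  then have lim: "(h \<longlongrightarrow> h 0) (at_right 0)"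
    unfolding h_def[abs_def] by (rule lim_real_of_ereal)
  have "((\<lambda>x. h k + d k * (x - k)) \<longlongrightarrow> h k + d k * (0 - k)) (at_right 0)"
    by (intro tendsto_intros)
  moreover have "eventually (\<lambda>x. h k + d k * (x - k) \<le> h x) (at_right 0)"
    using k h_above_tangent_interior[OF k(1)]
    by (auto simp: eventually_at_right_field intro!: exI[of _ k] less_imp_le)
  ultimately have "h k + d k * (0 - k) \<le> h 0"
    using lim tendsto_le[of "at_right (0::real)"] by auto
  moreover have "h m + d m * (k - m) < h k"
    using k m by (intro h_above_tangent_interior) auto
  moreover have "k * (d m - d k) > 0"
    using k m d_strict_mono by simp
  ultimately show ?thesis
    by (simp add: algebra_simps)
qed

lemma h_above_tangent:
  assumes m: "m \<in> {0<..<1}" and "x \<in> {0..1}" "x \<noteq> m" "c x \<noteq> \<infinity>"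
  shows "h m + d m * (x - m) < h x"
proof -
  consider "x = 0" | "x = 1" | "x \<in> {0<..<1}"
    using assms by force
  then show ?thesis
  proof cases
    case 1
    then show ?thesis
      using h_above_tangent_0[OF m] assms by simp
  next
    case 2
    \<comment> \<open>Reflection reduces the endpoint 1 to the endpoint 0.\<close>
    have "c 0 \<noteq> \<infinity>"
      using 2 c_sym[of 0] assms by simp
    then have "h (1 - m) - d (1 - m) * (1 - m) < h 0"
      using m by (intro h_above_tangent_0) auto
    then show ?thesis
      using 2 d_sym[OF m] h_sym[of m] h_sym[of 0] m by (simp add: algebra_simps)
  next
    case 3
    then show ?thesis
      using assms h_above_tangent_interior by simp
  qed
qed

lemma h_above_tangent_le:
  assumes "m \<in> {0<..<1}" "x \<in> {0..1}" "c x \<noteq> \<infinity>"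
  shows "h m + d m * (x - m) \<le> h x"
  using h_above_tangent[OF assms(1,2) _ assms(3)] by (cases "x = m") auto

lemma c_lower_bound:
  assumes "x \<in> {0..1}"
  shows "ereal (h (1/2)) \<le> c x"
proof (cases "c x = \<infinity>")
  case False
  have "d (1/2) = 0"
    using d_sym[of "1/2"] by simp
  then have "h (1/2) \<le> h x"
    using h_above_tangent_le[OF _ assms False, of "1/2"] by simp
  then show ?thesis
    using c_eq_h'[OF assms False] by simp
qed simp

text \<open>The Inada condition pushes \<open>d\<close> below \<open>- 1 / lam\<close> near 0, and
  \<open>d\<close> vanishes at 1/2 by symmetry. The intermediate value theorem gives a point in
  between, whose reflection is the threshold.\<close>

lemma ex_threshold: "\<exists>q. q \<in> {1/2<..<1} \<and> lam * d q = 1"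
proof -
  have d_half: "d (1/2) = 0"
    using d_sym[of "1/2"] by simp
  have "eventually (\<lambda>x. d x \<le> - 1 / lam) (at_right 0)"
    using d_at_bot by (simp add: filterlim_at_bot)
  moreover have "eventually (\<lambda>x. x \<in> {0<..<1/2}) (at_right (0::real))"
    by (rule eventually_at_right_real) simp
  ultimately have "eventually (\<lambda>x. d x \<le> - 1 / lam \<and> x \<in> {0<..<1/2}) (at_right 0)"
    by (rule eventually_conj)
  then obtain a where a: "d a \<le> - 1 / lam" "0 < a" "a < 1/2"
    using eventually_happens'[OF trivial_limit_at_right_real] by fastforce
  have "continuous_on {a..1/2} d"
    using d_cont by (rule continuous_on_subset) (use a in auto)
  then obtain p where p: "a \<le> p" "p \<le> 1/2" "d p = - 1 / lam"
    using IVT'[of d a "- 1 / lam" "1/2"] a d_half lam_pos by (auto simp: less_imp_le)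
  have "p \<noteq> 1/2"
  proof
    assume "p = 1/2"
    then have "d p = 0"
      using d_half by (simp only:)
    then show False
      using p lam_pos by simp
  qed
  then have "1 - p \<in> {1/2<..<1}"
    using p a by simp
  moreover have "lam * d (1 - p) = 1"
    using p a d_sym[of p] lam_pos by simp
  ultimately show ?thesis
    by blast
qed

definition q :: real where
  "q = (SOME q. q \<in> {1/2<..<1} \<and> lam * d q = 1)"

lemma q: "1/2 < q" "q < 1" "lam * d q = 1"
  using someI_ex[OF ex_threshold] unfolding q_def by auto

lemma q_flip: "lam * d (1 - q) = - 1" "h (1 - q) = h q"
  using q d_sym[of q] h_sym[of q] by auto

section \<open>Supporting lines of the agent's problem\<close>

definition belief_payoff :: "action \<Rightarrow> real \<Rightarrow> real" where
  "belief_payoff a x = (case a of ActL \<Rightarrow> 1 - x | ActR \<Rightarrow> x)"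

text \<open>Height of the line \<open>\<alpha> + \<beta> * x\<close> above the net payoff of action \<open>a\<close> at the belief \<open>x\<close>. Where \<open>c x\<close> is
  infinite, \<open>h x\<close> is the junk value 0, so \<open>supports\<close> and \<open>tight\<close> treat such beliefs separately.\<close>
definition gap :: "real \<Rightarrow> real \<Rightarrow> action \<Rightarrow> real \<Rightarrow> real" where
  "gap \<alpha> \<beta> a x = \<alpha> + \<beta> * x - belief_payoff a x + lam * h x"

definition supports :: "real \<Rightarrow> real \<Rightarrow> bool" where
  "supports \<alpha> \<beta> \<longleftrightarrow> (\<forall>a. \<forall>x\<in>{0..1}. c x \<noteq> \<infinity> \<longrightarrow> 0 \<le> gap \<alpha> \<beta> a x)"

text \<open>Complementary slackness for the supporting line, imposed only at signals of positive
  probability.\<close>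

definition tight :: "real \<Rightarrow> real \<Rightarrow> real \<Rightarrow> 's strategy \<Rightarrow> bool" where
  "tight \<alpha> \<beta> m st \<longleftrightarrow> (\<forall>s\<in>set_pmf (signal_dist m (fst st)).
     c (posterior m (fst st) s) \<noteq> \<infinity> \<and>
     (\<forall>a. pmf (snd st s) a = 0 \<or> gap \<alpha> \<beta> a (posterior m (fst st) s) = 0))"

text \<open>The slack lost at signal \<open>s\<close>, averaged over the choice rule. Where the cost
  is finite, its expectation is the exact shortfall of the objective from the dual bound.\<close>

definition mean_gap :: "real \<Rightarrow> real \<Rightarrow> real \<Rightarrow> 's strategy \<Rightarrow> 's \<Rightarrow> real" where
  "mean_gap \<alpha> \<beta> m st s =
     pmf (snd st s) ActR * gap \<alpha> \<beta> ActR (posterior m (fst st) s) +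
     pmf (snd st s) ActL * gap \<alpha> \<beta> ActL (posterior m (fst st) s)"

definition interim_payoff :: "real \<Rightarrow> 's strategy \<Rightarrow> 's \<Rightarrow> real" where
  "interim_payoff m st s = posterior m (fst st) s * pmf (snd st s) ActR +
    (1 - posterior m (fst st) s) * pmf (snd st s) ActL"

lemma mean_gap_eq:
  "mean_gap \<alpha> \<beta> m st s = \<alpha> + \<beta> * posterior m (fst st) s + lam * h (posterior m (fst st) s)
    - interim_payoff m st s"
proof -
  have *: "pmf (snd st s) ActL = 1 - pmf (snd st s) ActR"
    using pmf_action_sum[of "snd st s"] by simp
  show ?thesis
    unfolding mean_gap_def gap_def belief_payoff_def interim_payoff_def *
    by (simp add: algebra_simps)
qed

lemma integrable_payoff:
  assumes "m \<in> {0..1}"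
  shows "integrable (measure_pmf (signal_dist m (fst st))) (interim_payoff m st)"
  unfolding interim_payoff_def[abs_def]
  using assms by (intro Bochner_Integration.integrable_add posterior_integrable) (auto simp: pmf_le_1)

lemma mean_gap_integrable:
  assumes "m \<in> {0..1}"
    and "integrable (measure_pmf (signal_dist m (fst st))) (\<lambda>s. h (posterior m (fst st) s))"
  shows "integrable (measure_pmf (signal_dist m (fst st))) (mean_gap \<alpha> \<beta> m st)"
  unfolding mean_gap_eq[abs_def]
  using integrable_payoff[OF assms(1), of st] assms(2)
    posterior_integrable(1)[OF assms(1), of "\<lambda>_. 1" "fst st"]
  by simp

text \<open>The posterior has mean \<open>m\<close>, so the line contributes
  \<open>\<alpha> + \<beta> * m\<close> whatever the signal structure is. The identity holds for
  every line; support enters only through the sign of \<open>mean_gap\<close>.\<close>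

lemma objective_finite:
  assumes m: "m \<in> {0<..<1}"
    and fin: "\<forall>s\<in>set_pmf (signal_dist m (fst st)). c (posterior m (fst st) s) \<noteq> \<infinity>"
    and int: "integrable (measure_pmf (signal_dist m (fst st))) (\<lambda>s. h (posterior m (fst st) s))"
  shows "agent_objective c lam m st = ereal (\<alpha> + \<beta> * m + lam * h m
    - measure_pmf.expectation (signal_dist m (fst st)) (mean_gap \<alpha> \<beta> m st))"
proof -
  let ?E = "measure_pmf.expectation (signal_dist m (fst st))"
  let ?x = "posterior m (fst st)"
  have m': "m \<in> {0..1}"
    using m by simp
  have "expectation_ereal (signal_dist m (fst st)) (\<lambda>s. c (?x s)) = ereal (?E (\<lambda>s. h (?x s)))"
    using fin int c_eq_h'[OF posterior_bounds[OF m', of "fst st"]] by (intro expectation_ereal_eq) auto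
  then have obj: "agent_objective c lam m st
      = ereal (expected_payoff m st - lam * (?E (\<lambda>s. h (?x s)) - h m))"
    using c_eq_h[OF m] by (simp add: agent_objective_def info_cost_def)
  have int_x: "integrable (measure_pmf (signal_dist m (fst st))) ?x"
    using posterior_integrable(1)[OF m', of "\<lambda>_. 1" "fst st"] by simp
  have payoff: "expected_payoff m st = ?E (interim_payoff m st)"
    unfolding interim_payoff_def[abs_def] by (rule expected_payoff_posterior[OF m'])
  have "?E (mean_gap \<alpha> \<beta> m st) = \<alpha> + \<beta> * ?E ?x + lam * ?E (\<lambda>s. h (?x s)) - expected_payoff m st"
    unfolding mean_gap_eq[abs_def] payoff
    using integrable_payoff[OF m', of st] int int_x by simp
  then show ?thesis
    unfolding obj by (simp add: expectation_posterior_eq_prior[OF m'] algebra_simps)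
qed

text \<open>Since \<open>c\<close> is bounded below by its value at 1/2, a failure of finiteness or
  integrability can only make the cost infinite.\<close>

lemma objective_infinite:
  assumes m: "m \<in> {0<..<1}"
    and "\<not> ((\<forall>s\<in>set_pmf (signal_dist m (fst st)). c (posterior m (fst st) s) \<noteq> \<infinity>) \<and>
      integrable (measure_pmf (signal_dist m (fst st))) (\<lambda>s. h (posterior m (fst st) s)))"
  shows "agent_objective c lam m st = - \<infinity>"
proof -
  have "expectation_ereal (signal_dist m (fst st)) (\<lambda>s. c (posterior m (fst st) s)) = \<infinity>"
    using m assms(2) c_lower_bound posterior_bounds[of m "fst st"]
    by (intro expectation_ereal_infinite[of _ "h (1/2)"]) (auto simp: h_def)
  then show ?thesis
    using c_eq_h[OF m] lam_pos by (simp add: agent_objective_def info_cost_def)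
qed

lemma mean_gap_nonneg:
  assumes "m \<in> {0..1}" "supports \<alpha> \<beta>" "c (posterior m (fst st) s) \<noteq> \<infinity>"
  shows "0 \<le> mean_gap \<alpha> \<beta> m st s"
  using assms posterior_bounds[OF assms(1), of "fst st" s] unfolding supports_def mean_gap_def
  by (intro add_nonneg_nonneg mult_nonneg_nonneg) auto

text \<open>Weak duality together with its equality case: the expected slack is nonnegative, and it
  is zero only if no slack is lost anywhere.\<close>

lemma objective_le:
  assumes m: "m \<in> {0<..<1}" and sup: "supports \<alpha> \<beta>"
  shows "agent_objective c lam m st \<le> ereal (\<alpha> + \<beta> * m + lam * h m)"
    and "agent_objective c lam m st = ereal (\<alpha> + \<beta> * m + lam * h m) \<Longrightarrow> tight \<alpha> \<beta> m st"
proof -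
  let ?p = "signal_dist m (fst st)"
  let ?x = "posterior m (fst st)"
  have m': "m \<in> {0..1}"
    using m by simp
  have "agent_objective c lam m st \<le> ereal (\<alpha> + \<beta> * m + lam * h m) \<and>
    (agent_objective c lam m st = ereal (\<alpha> + \<beta> * m + lam * h m) \<longrightarrow> tight \<alpha> \<beta> m st)"
  proof (cases "(\<forall>s\<in>set_pmf ?p. c (?x s) \<noteq> \<infinity>) \<and> integrable (measure_pmf ?p) (\<lambda>s. h (?x s))")
    case False
    then show ?thesis
      using objective_infinite[OF m False] by simp
  next
    case True
    then have fin: "\<forall>s\<in>set_pmf ?p. c (?x s) \<noteq> \<infinity>" by blast
    have obj: "agent_objective c lam m st = ereal (\<alpha> + \<beta> * m + lam * h m
        - measure_pmf.expectation ?p (mean_gap \<alpha> \<beta> m st))"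
      using True by (intro objective_finite[OF m]) blast+
    have nonneg: "AE s in measure_pmf ?p. 0 \<le> mean_gap \<alpha> \<beta> m st s"
      using fin mean_gap_nonneg[OF m' sup, of st] by (auto simp: AE_measure_pmf_iff)
    have "tight \<alpha> \<beta> m st" if zero: "measure_pmf.expectation ?p (mean_gap \<alpha> \<beta> m st) = 0"
      unfolding tight_def
    proof (intro ballI conjI allI)
      fix s a assume s: "s \<in> set_pmf ?p"
      then show finite: "c (?x s) \<noteq> \<infinity>"
        using fin by blast
      \<comment> \<open>The signal law is discrete, so a nonnegative function with zero expectation
        vanishes at every signal in the support.\<close>
      have "AE s in measure_pmf ?p. mean_gap \<alpha> \<beta> m st s = 0"
        using zero nonneg True mean_gap_integrable[OF m', of st]
        by (subst integral_nonneg_eq_0_iff_AE[symmetric]) auto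
      then have "mean_gap \<alpha> \<beta> m st s = 0"
        using s by (simp add: AE_measure_pmf_iff)
      moreover have "0 \<le> pmf (snd st s) b * gap \<alpha> \<beta> b (?x s)" for b
        using sup finite posterior_bounds[OF m', of "fst st" s] unfolding supports_def by auto
      ultimately have "pmf (snd st s) ActR * gap \<alpha> \<beta> ActR (?x s) = 0"
        "pmf (snd st s) ActL * gap \<alpha> \<beta> ActL (?x s) = 0"
        unfolding mean_gap_def by (metis add_nonneg_eq_0_iff)+
      then show "pmf (snd st s) a = 0 \<or> gap \<alpha> \<beta> a (?x s) = 0"
        by (cases a) auto
    qed
    moreover have "0 \<le> measure_pmf.expectation ?p (mean_gap \<alpha> \<beta> m st)"
      using nonneg by (rule integral_nonneg_AE)
    ultimately show ?thesis
      unfolding obj by auto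
  qed
  then show "agent_objective c lam m st \<le> ereal (\<alpha> + \<beta> * m + lam * h m)"
    and "agent_objective c lam m st = ereal (\<alpha> + \<beta> * m + lam * h m) \<Longrightarrow> tight \<alpha> \<beta> m st"
    by auto
qed

text \<open>Having at most two posteriors bounds \<open>h\<close> along the support and hence makes
  it integrable; the strategies constructed later have this form.\<close>

lemma objective_tight:
  assumes m: "m \<in> {0<..<1}" and "tight \<alpha> \<beta> m st"
    and two: "posterior m (fst st) ` set_pmf (signal_dist m (fst st)) \<subseteq> {x, y}"
  shows "agent_objective c lam m st = ereal (\<alpha> + \<beta> * m + lam * h m)"
proof -
  let ?p = "signal_dist m (fst st)"
  have int: "integrable (measure_pmf ?p) (\<lambda>s. h (posterior m (fst st) s))"
    using two by (intro integrable_pmf_bounded[of _ _ "\<bar>h x\<bar> + \<bar>h y\<bar>"]) auto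
  have "pmf (snd st s) a * gap \<alpha> \<beta> a (posterior m (fst st) s) = 0" if "s \<in> set_pmf ?p" for s a
    using assms(2) that unfolding tight_def by simp
  then have "AE s in measure_pmf ?p. mean_gap \<alpha> \<beta> m st s = 0"
    unfolding AE_measure_pmf_iff mean_gap_def by (metis add_0)
  then have "measure_pmf.expectation ?p (mean_gap \<alpha> \<beta> m st) = 0"
    by (rule integral_eq_zero_AE)
  then show ?thesis
    using objective_finite[OF m _ int, of \<alpha> \<beta>] assms(2) by (simp add: tight_def)
qed

text \<open>A tight strategy attains the dual bound, so every maximiser must attain it as well, and
  the equality case of duality applies. One witness thus yields existence and the shape of all
  optima.\<close>

lemma arg_max_tight:
  fixes st st0 :: "'s strategy"
  assumes m: "m \<in> {0<..<1}" and sup: "supports \<alpha> \<beta>" and "tight \<alpha> \<beta> m st0"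
    and two: "posterior m (fst st0) ` set_pmf (signal_dist m (fst st0)) \<subseteq> {x, y}"
  shows "is_arg_max (agent_objective c lam m) (\<lambda>_. True) st0"
    and "is_arg_max (agent_objective c lam m) (\<lambda>_. True) st \<Longrightarrow> tight \<alpha> \<beta> m st"
proof -
  have attained: "agent_objective c lam m st0 = ereal (\<alpha> + \<beta> * m + lam * h m)"
    using objective_tight[OF m assms(3) two] .
  then show "is_arg_max (agent_objective c lam m) (\<lambda>_. True) st0"
    using objective_le(1)[OF m sup] unfolding is_arg_max_def by (metis not_less)
  show "tight \<alpha> \<beta> m st" if "is_arg_max (agent_objective c lam m) (\<lambda>_. True) st"
    using that attained objective_le[OF m sup, of st]
    by (metis is_arg_max_def order_le_less)
qed

section \<open>Optimal behaviour of the agents\<close>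

text \<open>The payoffs of the two actions have slopes 1 and -1, which equal the slopes of
  \<open>lam * h\<close> at \<open>q\<close> and \<open>1 - q\<close>. So each gap is
  \<open>lam\<close> times the height of \<open>h\<close> above its tangent at one of these points,
  and \<open>h (1 - q) = h q\<close> makes a single horizontal line fit both.\<close>

lemma supports_flat:
  shows "supports (q - lam * h q) 0"
    and "\<lbrakk>x \<in> {0..1}; c x \<noteq> \<infinity>\<rbrakk> \<Longrightarrow> gap (q - lam * h q) 0 ActR x = 0 \<longleftrightarrow> x = q"
    and "\<lbrakk>x \<in> {0..1}; c x \<noteq> \<infinity>\<rbrakk> \<Longrightarrow> gap (q - lam * h q) 0 ActL x = 0 \<longleftrightarrow> x = 1 - q"
proof -
  have "lam * (d q * (x - q)) = x - q" "lam * (d (1 - q) * (x - (1 - q))) = 1 - q - x" for x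
    using q(3) q_flip(1) by (simp_all flip: mult.assoc)
  then have R: "gap (q - lam * h q) 0 ActR x = lam * (h x - (h q + d q * (x - q)))"
    and L: "gap (q - lam * h q) 0 ActL x = lam * (h x - (h (1 - q) + d (1 - q) * (x - (1 - q))))" for x
    by (simp_all add: gap_def belief_payoff_def right_diff_distrib distrib_left q_flip(2))
  have pos: "0 < gap (q - lam * h q) 0 ActR x" if "x \<in> {0..1}" "c x \<noteq> \<infinity>" "x \<noteq> q" for x
    using h_above_tangent[of q x] q that lam_pos unfolding R by simp
  have pos': "0 < gap (q - lam * h q) 0 ActL x" if "x \<in> {0..1}" "c x \<noteq> \<infinity>" "x \<noteq> 1 - q" for x
    using h_above_tangent[of "1 - q" x] q that lam_pos unfolding L by simp
  have zero: "gap (q - lam * h q) 0 ActR q = 0" "gap (q - lam * h q) 0 ActL (1 - q) = 0"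
    unfolding R L by simp_all
  show "gap (q - lam * h q) 0 ActR x = 0 \<longleftrightarrow> x = q"
    "gap (q - lam * h q) 0 ActL x = 0 \<longleftrightarrow> x = 1 - q"
    if "x \<in> {0..1}" "c x \<noteq> \<infinity>"
    using pos[OF that] pos'[OF that] zero by fastforce+
  show "supports (q - lam * h q) 0"
    unfolding supports_def
  proof (intro allI ballI impI)
    fix a x assume x: "x \<in> {0..1::real}" "c x \<noteq> \<infinity>"
    show "0 \<le> gap (q - lam * h q) 0 a x"
      using pos[OF x] pos'[OF x] zero q(1)
      by (cases a; cases "x = q"; cases "x = 1 - q") (auto intro: less_imp_le)
  qed
qed

text \<open>The line is tangent at \<open>m\<close> to the net payoff of \<open>ActR\<close>. The
  work is to show that it stays strictly above the net payoff of \<open>ActL\<close>.\<close>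

lemma supports_high:
  assumes m: "q < m" "m < 1"
  defines "\<beta> \<equiv> 1 - lam * d m"
  defines "\<alpha> \<equiv> m - lam * h m - \<beta> * m"
  shows "supports \<alpha> \<beta>"
    and "\<lbrakk>x \<in> {0..1}; c x \<noteq> \<infinity>\<rbrakk> \<Longrightarrow> gap \<alpha> \<beta> ActL x \<noteq> 0"
    and "gap \<alpha> \<beta> ActR m = 0"
proof -
  have m': "m \<in> {0<..<1}" "1 - m \<in> {0<..<1}" "1/2 < m"
    using m q by auto
  have "d q < d m"
    using m q by (intro d_strict_mono) auto
  then have \<beta>: "\<beta> < 0"
    using q(3) lam_pos mult_strict_left_mono[of "d q" "d m" lam] by (simp add: \<beta>_def)
  have R: "gap \<alpha> \<beta> ActR x = lam * (h x - (h m + d m * (x - m)))" for x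
    by (simp add: gap_def belief_payoff_def \<alpha>_def \<beta>_def algebra_simps)
  have L: "gap \<alpha> \<beta> ActL x = lam * (h x - (h m + d m * (x - m))) + (2 * x - 1)" for x
    by (simp add: gap_def belief_payoff_def \<alpha>_def \<beta>_def algebra_simps)
  \<comment> \<open>The same gap measured from the tangent at \<open>1 - m\<close>. It serves
    beliefs below 1/2, where the remainder \<open>2 * x - 1\<close> of the previous form is negative
    but \<open>\<beta> * (2 * x - 1)\<close> is positive.\<close>
  have L': "gap \<alpha> \<beta> ActL x
      = lam * (h x - (h (1 - m) + d (1 - m) * (x - (1 - m)))) + \<beta> * (2 * x - 1)" for x
    using h_sym[of m] d_sym[of m] m'
    by (simp add: gap_def belief_payoff_def \<alpha>_def \<beta>_def algebra_simps)
  show "gap \<alpha> \<beta> ActR m = 0"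
    unfolding R by simp
  have posR: "0 \<le> gap \<alpha> \<beta> ActR x" if "x \<in> {0..1}" "c x \<noteq> \<infinity>" for x
    using h_above_tangent_le[OF m'(1) that] lam_pos unfolding R by simp
  have posL: "0 < gap \<alpha> \<beta> ActL x" if "x \<in> {0..1}" "c x \<noteq> \<infinity>" for x
  proof (cases x "1/2 :: real" rule: linorder_cases)
    case less
    then have "0 < \<beta> * (2 * x - 1)"
      using \<beta> by (intro mult_neg_neg) auto
    then show ?thesis
      using h_above_tangent_le[OF m'(2) that] lam_pos unfolding L'
      by (intro add_nonneg_pos mult_nonneg_nonneg) auto
  next
    case equal
    then show ?thesis
      using h_above_tangent[OF m'(1) that(1) _ that(2)] m' lam_pos
      unfolding L by (intro add_pos_nonneg mult_pos_pos) auto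
  next
    case greater
    then show ?thesis
      using h_above_tangent_le[OF m'(1) that] lam_pos unfolding L
      by (intro add_nonneg_pos mult_nonneg_nonneg) auto
  qed
  then show "\<lbrakk>x \<in> {0..1}; c x \<noteq> \<infinity>\<rbrakk> \<Longrightarrow> gap \<alpha> \<beta> ActL x \<noteq> 0"
    by fastforce
  show "supports \<alpha> \<beta>"
    unfolding supports_def using posR posL by (metis action.exhaust less_imp_le)
qed

text \<open>Mirror image of the high case: swapping the actions and replacing \<open>x\<close> by
  \<open>1 - x\<close> turns the line \<open>\<alpha> + \<beta> * x\<close> into
  \<open>(\<alpha> + \<beta>) - \<beta> * x\<close>.\<close>

lemma supports_low:
  assumes m: "0 < m" "m < 1 - q"
  shows "\<exists>\<alpha> \<beta>. supports \<alpha> \<beta> \<and> (\<forall>x\<in>{0..1}. c x \<noteq> \<infinity> \<longrightarrow> gap \<alpha> \<beta> ActR x \<noteq> 0) \<and> gap \<alpha> \<beta> ActL m = 0"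
proof -
  have n: "q < 1 - m" "1 - m < 1"
    using m by auto
  define \<beta> where "\<beta> = 1 - lam * d (1 - m)"
  define \<alpha> where "\<alpha> = (1 - m) - lam * h (1 - m) - \<beta> * (1 - m)"
  note high = supports_high[OF n, folded \<beta>_def, folded \<alpha>_def]
  have flip: "gap (\<alpha> + \<beta>) (- \<beta>) ActR x = gap \<alpha> \<beta> ActL (1 - x)"
    "gap (\<alpha> + \<beta>) (- \<beta>) ActL x = gap \<alpha> \<beta> ActR (1 - x)" if "x \<in> {0..1}" for x
    using h_sym[OF that] by (simp_all add: gap_def belief_payoff_def algebra_simps)
  have mirror: "1 - x \<in> {0..1}" "c (1 - x) \<noteq> \<infinity>" if "x \<in> {0..1}" "c x \<noteq> \<infinity>" for x
    using that c_sym[OF that(1)] by auto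
  have "0 \<le> gap (\<alpha> + \<beta>) (- \<beta>) a x" if "x \<in> {0..1}" "c x \<noteq> \<infinity>" for a x
    using high(1) mirror[OF that] flip[OF that(1)] unfolding supports_def by (cases a) auto
  then have "supports (\<alpha> + \<beta>) (- \<beta>)"
    by (simp add: supports_def)
  moreover have "\<forall>x\<in>{0..1}. c x \<noteq> \<infinity> \<longrightarrow> gap (\<alpha> + \<beta>) (- \<beta>) ActR x \<noteq> 0"
    using high(2) mirror flip by metis
  moreover have "gap (\<alpha> + \<beta>) (- \<beta>) ActL m = 0"
    using high(3) flip(2)[of m] m q by auto
  ultimately show ?thesis
    by blast
qed

section \<open>Choice probabilities forced by tightness\<close>

lemma choice_prob_posterior:
  assumes "m \<in> {0..1}"
  shows "m * choice_prob st ActR StateR = measure_pmf.expectation (signal_dist m (fst st))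
      (\<lambda>s. posterior m (fst st) s * pmf (snd st s) ActR)"
    and "(1 - m) * choice_prob st ActL StateL = measure_pmf.expectation (signal_dist m (fst st))
      (\<lambda>s. (1 - posterior m (fst st) s) * pmf (snd st s) ActL)"
  by (simp_all add: choice_prob_def expectation_posterior[OF assms])

text \<open>Tightness ties \<open>ActR\<close> to the posterior \<open>q\<close> and
  \<open>ActL\<close> to \<open>1 - q\<close>, so the mean \<open>m\<close> of the posterior
  determines the overall probability \<open>T\<close> of \<open>ActR\<close>. The formulas are
  arranged so that the prior enters only through its reciprocal and that of
  \<open>1 - m\<close>.\<close>

lemma choice_prob_flat:
  assumes m: "m \<in> {0<..<1}" and tight: "tight (q - lam * h q) 0 m st"
  shows "choice_prob st ActR StateR = q / (2 * q - 1) * (1 - (1 - q) / m)"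
    and "choice_prob st ActL StateL = q / (2 * q - 1) * (1 - (1 - q) / (1 - m))"
proof -
  let ?p = "signal_dist m (fst st)"
  let ?E = "measure_pmf.expectation ?p"
  let ?x = "posterior m (fst st)"
  let ?r = "\<lambda>s. pmf (snd st s) ActR"
  let ?l = "\<lambda>s. pmf (snd st s) ActL"
  have m': "m \<in> {0..1}"
    using m by simp
  have point: "?x s * ?r s = q * ?r s \<and> ?x s * ?l s = (1 - q) * ?l s" if "s \<in> set_pmf ?p" for s
    using tight that supports_flat(2,3)[OF posterior_bounds[OF m', of "fst st" s]]
    unfolding tight_def by fastforce
  define T where "T = ?E ?r"
  have int: "integrable (measure_pmf ?p) ?r" "integrable (measure_pmf ?p) ?l"
    by (auto intro!: integrable_pmf_bounded[of _ _ 1] simp: pmf_le_1)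
  have "?l s = 1 - ?r s" for s
    using pmf_action_sum[of "snd st s"] by simp
  then have l: "?E ?l = 1 - T"
    using int(1) by (simp add: T_def)
  have xr: "?E (\<lambda>s. ?x s * ?r s) = q * T"
    using point unfolding T_def
    by (subst integral_mult_right_zero[symmetric], intro integral_cong_AE) (auto simp: AE_measure_pmf_iff)
  have xl: "?E (\<lambda>s. ?x s * ?l s) = (1 - q) * (1 - T)"
    using point unfolding l[symmetric]
    by (subst integral_mult_right_zero[symmetric], intro integral_cong_AE) (auto simp: AE_measure_pmf_iff)
  have int_x: "integrable (measure_pmf ?p) (\<lambda>s. ?x s * ?r s)" "integrable (measure_pmf ?p) (\<lambda>s. ?x s * ?l s)"
    by (auto intro!: posterior_integrable(1)[OF m'] simp: pmf_le_1)
  have "m = ?E (\<lambda>s. ?x s * ?r s + ?x s * ?l s)"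
    using expectation_posterior_eq_prior[OF m', of "fst st"] pmf_action_sum
    by (simp add: add.commute flip: distrib_left)
  then have T: "m = q * T + (1 - q) * (1 - T)"
    using int_x xr xl by simp
  have R: "m * choice_prob st ActR StateR = q * T"
    using choice_prob_posterior(1)[OF m', of st] xr by simp
  have "(1 - m) * choice_prob st ActL StateL = ?E (\<lambda>s. ?l s - ?x s * ?l s)"
    using choice_prob_posterior(2)[OF m', of st] by (simp add: left_diff_distrib)
  then have L: "(1 - m) * choice_prob st ActL StateL = q * (1 - T)"
    using int int_x l xl by (simp add: algebra_simps)
  have T_eq: "T = (m - (1 - q)) / (2 * q - 1)"
    using T q by (simp add: field_simps)
  have "choice_prob st ActR StateR = q * T / m"
    using R m by (simp add: field_simps)
  then show "choice_prob st ActR StateR = q / (2 * q - 1) * (1 - (1 - q) / m)"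
    using m q unfolding T_eq by (simp add: field_simps)
  have "choice_prob st ActL StateL = q * (1 - T) / (1 - m)"
    using L m by (simp add: field_simps)
  moreover have "1 - T = ((1 - m) - (1 - q)) / (2 * q - 1)"
    using q unfolding T_eq by (simp add: field_simps)
  ultimately show "choice_prob st ActL StateL = q / (2 * q - 1) * (1 - (1 - q) / (1 - m))"
    using m q by (simp add: field_simps)
qed

text \<open>At a non-degenerate prior, every signal that is possible in some state lies in the
  support of the unconditional law.\<close>

lemma choice_prob_unused_action:
  assumes "\<And>s. s \<in> set_pmf (signal_dist m (fst st)) \<Longrightarrow> pmf (snd st s) a = 0"
    and m: "m \<in> {0<..<1}"
  shows "choice_prob st a \<omega> = 0"
proof -
  have "pmf (snd st s) a = 0" if "s \<in> set_pmf (fst st \<omega>)" for s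
  proof (rule assms(1))
    have "0 < pmf (fst st \<omega>) s"
      using that by (simp add: pmf_positive)
    then have "0 < (1 - m) * pmf (fst st StateL) s + m * pmf (fst st StateR) s"
      using m by (cases \<omega>) (simp_all add: add_pos_nonneg add_nonneg_pos)
    then show "s \<in> set_pmf (signal_dist m (fst st))"
      using m by (simp add: set_pmf_iff pmf_signal_dist)
  qed
  then show ?thesis
    unfolding choice_prob_def by (intro integral_eq_zero_AE) (simp add: AE_measure_pmf_iff)
qed

section \<open>Strategies that attain the dual bound\<close>

definition pure_strategy :: "'s \<Rightarrow> action \<Rightarrow> 's strategy" where
  "pure_strategy s a = (\<lambda>_. return_pmf s, \<lambda>_. return_pmf a)"

lemma pure_strategy_support:
  assumes m: "m \<in> {0<..<1}" and "s \<in> set_pmf (signal_dist m (fst (pure_strategy s1 a)))"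
  shows "posterior m (fst (pure_strategy s1 a)) s = m"
proof -
  have "pmf (signal_dist m (fst (pure_strategy s1 a))) s = indicator {s1} s"
    using m by (simp add: pmf_signal_dist pure_strategy_def algebra_simps indicator_def)
  then show ?thesis
    using m assms(2) pmf_prior[of m]
    by (auto simp: posterior_def set_pmf_iff pure_strategy_def indicator_def split: if_splits)
qed

lemma pure_strategy_tight:
  assumes m: "m \<in> {0<..<1}" and "gap \<alpha> \<beta> a m = 0"
  shows "tight \<alpha> \<beta> m (pure_strategy s1 a)"
  unfolding tight_def
proof (intro ballI conjI allI)
  fix s b assume "s \<in> set_pmf (signal_dist m (fst (pure_strategy s1 a)))"
  then have "posterior m (fst (pure_strategy s1 a)) s = m"
    by (rule pure_strategy_support[OF m])
  then show "c (posterior m (fst (pure_strategy s1 a)) s) \<noteq> \<infinity>"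
    "pmf (snd (pure_strategy s1 a) s) b = 0 \<or> gap \<alpha> \<beta> b (posterior m (fst (pure_strategy s1 a)) s) = 0"
    using m assms(2) c_neq_PInf[of m] by (auto simp: pure_strategy_def indicator_def)
qed

lemma pure_strategy_posteriors:
  assumes "m \<in> {0<..<1}"
  shows "posterior m (fst (pure_strategy s1 a)) `
    set_pmf (signal_dist m (fst (pure_strategy s1 a))) \<subseteq> {m, m}"
  using pure_strategy_support[OF assms] by auto

text \<open>\<open>T\<close> is the probability of the posterior \<open>q\<close>, from \<open>m = q * T + (1 - q) * (1 - T)\<close>.\<close>
definition split_strategy :: "'s \<Rightarrow> 's \<Rightarrow> real \<Rightarrow> 's strategy" where
  "split_strategy s1 s2 m =
    (let T = (m - (1 - q)) / (2 * q - 1) in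
     (\<lambda>\<omega>. map_pmf (\<lambda>b. if b then s2 else s1)
        (bernoulli_pmf (case \<omega> of StateR \<Rightarrow> q * T / m | StateL \<Rightarrow> (1 - q) * T / (1 - m))),
      \<lambda>s. return_pmf (if s = s2 then ActR else ActL)))"

lemma split_strategy_support:
  assumes ne: "s1 \<noteq> s2" and m: "m \<in> {1 - q..q}"
    and s: "s \<in> set_pmf (signal_dist m (fst (split_strategy s1 s2 m)))"
  shows "s = s2 \<and> posterior m (fst (split_strategy s1 s2 m)) s = q \<or>
    s = s1 \<and> posterior m (fst (split_strategy s1 s2 m)) s = 1 - q"
proof -
  let ?\<phi> = "fst (split_strategy s1 s2 m)"
  let ?x = "posterior m ?\<phi> s"
  let ?p = "pmf (signal_dist m ?\<phi>) s"
  define T where "T = (m - (1 - q)) / (2 * q - 1)"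
  have m': "m \<in> {0<..<1}" "m \<in> {0..1}"
    using m q by auto
  have T: "0 \<le> T" "T \<le> 1"
    using m q by (auto simp: T_def field_simps)
  have "T * (2 * q - 1) = m - (1 - q)"
    using q by (simp add: T_def)
  then have mT: "m = q * T + (1 - q) * (1 - T)"
    by (simp add: algebra_simps)
  \<comment> \<open>\<open>bernoulli_pmf\<close> gives its usual weights only for parameters in the
    unit interval.\<close>
  have prob: "q * T / m \<in> {0..1}" "(1 - q) * T / (1 - m) \<in> {0..1}"
  proof -
    have "0 \<le> (1 - q) * (1 - T)" "0 \<le> q * (1 - T)"
      using T q by (simp_all add: mult_nonneg_nonneg)
    then have "q * T \<le> m" "(1 - q) * T \<le> 1 - m"
      using mT by (simp_all add: algebra_simps)
    then show "q * T / m \<in> {0..1}" "(1 - q) * T / (1 - m) \<in> {0..1}"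
      using T q m' by auto
  qed
  have \<phi>: "?\<phi> \<omega> = map_pmf (\<lambda>b. if b then s2 else s1)
      (bernoulli_pmf (case \<omega> of StateR \<Rightarrow> q * T / m | StateL \<Rightarrow> (1 - q) * T / (1 - m)))" for \<omega>
    unfolding split_strategy_def T_def Let_def by simp
  have vimage: "(\<lambda>b. if b then s2 else s1) -` {s2} = {True}" "(\<lambda>b. if b then s2 else s1) -` {s1} = {False}"
    using ne by (auto split: if_splits)
  \<comment> \<open>Joint probabilities of state and signal; dividing them by the unconditional
    weights \<open>T\<close> and \<open>1 - T\<close> gives the posteriors.\<close>
  have R: "m * pmf (?\<phi> StateR) s2 = q * T" "m * pmf (?\<phi> StateR) s1 = (1 - q) * (1 - T)"
    and L: "(1 - m) * pmf (?\<phi> StateL) s2 = (1 - q) * T" "(1 - m) * pmf (?\<phi> StateL) s1 = q * (1 - T)"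
    using prob m' mT unfolding \<phi> pmf_map vimage
    by (simp_all add: measure_pmf_single right_diff_distrib)
  have p: "pmf (signal_dist m ?\<phi>) s2 = T" "pmf (signal_dist m ?\<phi>) s1 = 1 - T"
    unfolding pmf_signal_dist[OF m'(2)] R L by (simp_all add: algebra_simps)
  have bayes: "?p * ?x = m * pmf (?\<phi> StateR) s"
    by (rule posterior_weights(1)[OF m'(2)])
  have "s = s2 \<or> s = s1"
    using s by (auto simp: signal_dist_def \<phi> split: if_splits)
  \<comment> \<open>At the ends of \<open>[1 - q, q]\<close> one of the signals has probability
    zero; membership in the support excludes it.\<close>
  moreover have "?p \<noteq> 0"
    using s by (simp add: set_pmf_iff)
  ultimately show ?thesis
    using bayes R p by auto
qed

lemma split_strategy_tight:
  assumes "s1 \<noteq> s2" and m: "m \<in> {1 - q..q}"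
  shows "tight (q - lam * h q) 0 m (split_strategy s1 s2 m)"
  unfolding tight_def
proof (intro ballI conjI allI)
  let ?st = "split_strategy s1 s2 m"
  fix s a assume "s \<in> set_pmf (signal_dist m (fst ?st))"
  note support = split_strategy_support[OF assms this]
  have "posterior m (fst ?st) s \<in> {0<..<1}"
    using support q by auto
  then show fin: "c (posterior m (fst ?st) s) \<noteq> \<infinity>"
    by (rule c_neq_PInf)
  have \<sigma>: "pmf (snd ?st s) b = (if b = (if s = s2 then ActR else ActL) then 1 else 0)" for b
    by (auto simp: split_strategy_def Let_def)
  show "pmf (snd ?st s) a = 0 \<or> gap (q - lam * h q) 0 a (posterior m (fst ?st) s) = 0"
    using support
  proof (elim disjE conjE)
    assume "s = s2" "posterior m (fst ?st) s = q"
    then show ?thesis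
      using supports_flat(2)[of q] q fin unfolding \<sigma> by auto
  next
    assume "s = s1" "posterior m (fst ?st) s = 1 - q"
    then show ?thesis
      using supports_flat(3)[of "1 - q"] q fin assms(1) unfolding \<sigma> by auto
  qed
qed

lemma split_strategy_posteriors:
  assumes "s1 \<noteq> s2" "m \<in> {1 - q..q}"
  shows "posterior m (fst (split_strategy s1 s2 m)) `
    set_pmf (signal_dist m (fst (split_strategy s1 s2 m))) \<subseteq> {q, 1 - q}"
  using split_strategy_support[OF assms] by blast

section \<open>What optimal agents yield to the principal\<close>

lemma optimal_interior:
  fixes prof :: "real \<Rightarrow> 's strategy"
  assumes "optimal_profile c lam prof" "m \<in> {0<..<1}"
  shows "is_arg_max (agent_objective c lam m) (\<lambda>_. True) (prof m)"
proof -
  have "agent_optimal c lam m (prof m)"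
    using assms by (simp add: optimal_profile_def)
  then show ?thesis
    using assms(2) by (simp add: agent_optimal_def)
qed

lemma optimal_degenerate:
  assumes "optimal_profile c lam prof"
  shows "choice_prob (prof 0) ActR \<omega> = 0" "choice_prob (prof 0) ActL \<omega> = 1"
    and "choice_prob (prof 1) ActR \<omega> = 1" "choice_prob (prof 1) ActL \<omega> = 0"
proof -
  have "agent_optimal c lam 0 (prof 0)" "agent_optimal c lam 1 (prof 1)"
    using assms by (auto simp: optimal_profile_def)
  then have "choice_prob (prof 0) ActL \<omega> = 1" "choice_prob (prof 1) ActR \<omega> = 1"
    by (auto simp: agent_optimal_def)
  then show "choice_prob (prof 0) ActR \<omega> = 0" "choice_prob (prof 0) ActL \<omega> = 1"
    "choice_prob (prof 1) ActR \<omega> = 1" "choice_prob (prof 1) ActL \<omega> = 0"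
    using choice_prob_sum[of "prof 0" \<omega>] choice_prob_sum[of "prof 1" \<omega>] by auto
qed

text \<open>The supporting line at \<open>m\<close> never touches the net payoff of
  \<open>ActL\<close>, so an optimal agent always takes \<open>ActR\<close>; at prior 1 this holds
  by convention.\<close>

lemma optimal_high:
  fixes prof :: "real \<Rightarrow> 's strategy"
  assumes opt: "optimal_profile c lam prof" and m: "q < m" "m \<le> 1"
  shows "principal_value mp (prof m) = mp"
proof -
  have "choice_prob (prof m) ActL \<omega> = 0" for \<omega>
  proof (cases "m = 1")
    case True
    then show ?thesis
      using optimal_degenerate(4)[OF opt] by simp
  next
    case False
    then have m1: "m < 1" and mi: "m \<in> {0<..<1}"
      using m q by auto
    note high = supports_high[OF m(1) m1]
    have "tight (m - lam * h m - (1 - lam * d m) * m) (1 - lam * d m) m (prof m)"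
      by (rule arg_max_tight(2)[OF mi high(1) pure_strategy_tight[OF mi high(3)]
          pure_strategy_posteriors[OF mi] optimal_interior[OF opt mi]])
    then have "pmf (snd (prof m) s) ActL = 0" if "s \<in> set_pmf (signal_dist m (fst (prof m)))" for s
      using high(2)[of "posterior m (fst (prof m)) s"] posterior_bounds[of m "fst (prof m)" s] mi that unfolding tight_def by auto
    then show ?thesis
      by (rule choice_prob_unused_action[OF _ mi])
  qed
  then show ?thesis
    using choice_prob_sum[of "prof m"] by (simp add: principal_value_def)
qed

lemma optimal_low:
  fixes prof :: "real \<Rightarrow> 's strategy"
  assumes opt: "optimal_profile c lam prof" and m: "0 \<le> m" "m < 1 - q"
  shows "principal_value mp (prof m) = 1 - mp"
proof -
  have "choice_prob (prof m) ActR \<omega> = 0" for \<omega>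
  proof (cases "m = 0")
    case True
    then show ?thesis
      using optimal_degenerate(1)[OF opt] by simp
  next
    case False
    then have m0: "0 < m" and mi: "m \<in> {0<..<1}"
      using m q by auto
    obtain \<alpha> \<beta> where low: "supports \<alpha> \<beta>" "gap \<alpha> \<beta> ActL m = 0"
      "\<And>x. \<lbrakk>x \<in> {0..1}; c x \<noteq> \<infinity>\<rbrakk> \<Longrightarrow> gap \<alpha> \<beta> ActR x \<noteq> 0"
      using supports_low[OF m0 m(2)] by blast
    have "tight \<alpha> \<beta> m (prof m)"
      by (rule arg_max_tight(2)[OF mi low(1) pure_strategy_tight[OF mi low(2)]
          pure_strategy_posteriors[OF mi] optimal_interior[OF opt mi]])
    then have "pmf (snd (prof m) s) ActR = 0" if "s \<in> set_pmf (signal_dist m (fst (prof m)))" for s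
      using low(3)[of "posterior m (fst (prof m)) s"] posterior_bounds[of m "fst (prof m)" s] mi that unfolding tight_def by auto
    then show ?thesis
      by (rule choice_prob_unused_action[OF _ mi])
  qed
  then show ?thesis
    using choice_prob_sum[of "prof m"] by (simp add: principal_value_def)
qed

definition clamp_prior :: "real \<Rightarrow> real" where
  "clamp_prior m = max (1 - q) (min q m)"

text \<open>The formula for agents who learn takes the value \<open>1 - mp\<close> at
  \<open>1 - q\<close> and \<open>mp\<close> at \<open>q\<close>. These are the values from always
  taking \<open>ActL\<close> or \<open>ActR\<close>, so clamping covers all three regimes.\<close>

lemma principal_value_optimal:
  fixes prof :: "real \<Rightarrow> 's strategy" and s1 s2 :: 's
  assumes opt: "optimal_profile c lam prof" and ne: "s1 \<noteq> s2" and m: "m \<in> {0..1}"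
  shows "principal_value mp (prof m) =
    q / (2 * q - 1) * (1 - (1 - q) * (mp / clamp_prior m + (1 - mp) / (1 - clamp_prior m)))"
proof -
  consider "m < 1 - q" | "m \<in> {1 - q..q}" | "q < m"
    by fastforce
  then show ?thesis
  proof cases
    case 1
    then have "clamp_prior m = 1 - q"
      using q by (simp add: clamp_prior_def)
    moreover have "1 - (1 - q) * (mp / (1 - q) + (1 - mp) / (1 - (1 - q))) = (1 - mp) * (2 * q - 1) / q"
      using q by (simp add: distrib_left) (simp add: field_simps)
    ultimately show ?thesis
      using optimal_low[OF opt _ 1] m q by simp
  next
    case 2
    then have mi: "m \<in> {0<..<1}" and clamp: "clamp_prior m = m"
      using q by (auto simp: clamp_prior_def)
    have "tight (q - lam * h q) 0 m (prof m)"
      by (rule arg_max_tight(2)[OF mi supports_flat(1) split_strategy_tight[OF ne 2]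
          split_strategy_posteriors[OF ne 2] optimal_interior[OF opt mi]])
    then show ?thesis
      unfolding principal_value_def clamp choice_prob_flat(1)[OF mi \<open>tight _ _ _ _\<close>]
        choice_prob_flat(2)[OF mi \<open>tight _ _ _ _\<close>]
      by (simp add: algebra_simps add_divide_distrib diff_divide_distrib)
  next
    case 3
    then have "clamp_prior m = q"
      using q by (simp add: clamp_prior_def)
    moreover have "1 - (1 - q) * (mp / q + (1 - mp) / (1 - q)) = mp * (2 * q - 1) / q"
      using q by (simp add: distrib_left) (simp add: field_simps)
    ultimately show ?thesis
      using optimal_high[OF opt 3] m q by simp
  qed
qed

text \<open>Two signals suffice: an agent in the learning region uses one per action, and all others
  send a constant signal.\<close>

lemma optimal_profile_exists:
  fixes s1 s2 :: 's
  assumes ne: "s1 \<noteq> s2"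
  shows "\<exists>prof :: real \<Rightarrow> 's strategy. optimal_profile c lam prof"
proof -
  have "\<exists>st :: 's strategy. agent_optimal c lam m st" if "m \<in> {0..1}" for m
  proof -
    have pure: "\<exists>st :: 's strategy. is_arg_max (agent_objective c lam m) (\<lambda>_. True) st"
      if "m \<in> {0<..<1}" "supports \<alpha> \<beta>" "gap \<alpha> \<beta> a m = 0" for \<alpha> \<beta> a
      using arg_max_tight(1)[OF that(1,2) pure_strategy_tight[OF that(1,3), of s1]
          pure_strategy_posteriors[OF that(1)]] by blast
    consider "m = 0" | "m = 1" | "m \<in> {0<..<1}" "m < 1 - q" | "m \<in> {0<..<1}" "m \<in> {1 - q..q}"
      | "m \<in> {0<..<1}" "q < m"
      using \<open>m \<in> {0..1}\<close> by fastforce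
    then show ?thesis
    proof cases
      case 1
      then have "agent_optimal c lam m (pure_strategy s1 ActL)"
        by (simp add: agent_optimal_def pure_strategy_def choice_prob_def)
      then show ?thesis by blast
    next
      case 2
      then have "agent_optimal c lam m (pure_strategy s1 ActR)"
        by (simp add: agent_optimal_def pure_strategy_def choice_prob_def)
      then show ?thesis by blast
    next
      case 3
      then show ?thesis
        using pure supports_low[of m] by (auto simp: agent_optimal_def)
    next
      case 4
      then have "agent_optimal c lam m (split_strategy s1 s2 m)"
        using arg_max_tight(1)[OF _ supports_flat(1) split_strategy_tight[OF ne]
            split_strategy_posteriors[OF ne]] by (simp add: agent_optimal_def)
      then show ?thesis by blast
    next
      case 5
      then show ?thesis
        using pure supports_high[of m] by (auto simp: agent_optimal_def)
    qed
  qed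
  then show ?thesis
    unfolding optimal_profile_def by metis
qed

end

section \<open>The principal's problem\<close>

lemma mu_star_bounds:
  assumes "1/2 \<le> mp" "mp \<le> 1"
  shows "1/2 \<le> mu_star mp" "mu_star mp \<le> 1"
proof -
  define a b where "a = sqrt mp" and "b = sqrt (1 - mp)"
  have "b \<le> a" "0 < a" "0 \<le> b"
    using assms by (auto simp: a_def b_def)
  then show "1/2 \<le> mu_star mp" "mu_star mp \<le> 1"
    unfolding mu_star_def a_def[symmetric] b_def[symmetric] by (simp_all add: field_simps)
qed

text \<open>With \<open>a\<close> and \<open>b\<close> the two square roots, the upper bound amounts
  to \<open>1 < a * (a + b)\<close>, which follows from \<open>a * a + b * b = 1\<close> and
  \<open>b < a\<close>.\<close>

lemma mu_star_between:
  assumes "1/2 < mp" "mp < 1"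
  shows "mu_star mp \<in> {1/2<..<mp}"
proof -
  define a b where "a = sqrt mp" and "b = sqrt (1 - mp)"
  have ab: "0 < b" "b < a"
    using assms by (auto simp: a_def b_def)
  have sq: "a * a = mp" "b * b = 1 - mp"
    using assms by (auto simp: a_def b_def)
  have "b * b < a * b"
    using ab by simp
  then have "1 < a * a + a * b"
    using sq by simp
  then have "a * 1 < a * (a * (a + b))"
    using ab by (intro mult_strict_left_mono) (auto simp: distrib_left)
  then have "a < mp * (a + b)"
    unfolding sq(1)[symmetric] by (simp add: mult.assoc)
  then show ?thesis
    using ab unfolding mu_star_def a_def[symmetric] b_def[symmetric] by (simp add: field_simps)
qed

text \<open>The second alternative serves the case in which \<open>mu_star mp\<close> is clamped to the threshold
  posterior.\<close>
lemma harmonic_loss_min: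
  assumes mp: "1/2 \<le> mp" "mp \<le> 1" and k: "0 < k" "k < 1" and j: "0 < j" "j < 1"
    and "j = mu_star mp \<or> k \<le> j \<and> j \<le> mu_star mp"
  shows "mp / j + (1 - mp) / (1 - j) \<le> mp / k + (1 - mp) / (1 - k)"
proof -
  define a b where "a = sqrt mp" and "b = sqrt (1 - mp)"
  have ab: "0 < a" "0 \<le> b"
    using mp by (auto simp: a_def b_def)
  have sq: "mp = a * a" "1 - mp = b * b"
    using mp by (auto simp: a_def b_def)
  \<comment> \<open>The equation is the first-order condition
    \<open>mp / x^2 = (1 - mp) / (1 - x)^2\<close> after taking square roots, with denominators
    cleared so that it also covers \<open>mp = 1\<close>.\<close>
  have star: "x \<le> mu_star mp \<longleftrightarrow> b * x \<le> a * (1 - x)" "x = mu_star mp \<longleftrightarrow> b * x = a * (1 - x)" for x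
  proof -
    have "x \<le> mu_star mp \<longleftrightarrow> x * (a + b) \<le> a" "x = mu_star mp \<longleftrightarrow> x * (a + b) = a"
      using ab unfolding mu_star_def a_def[symmetric] b_def[symmetric]
      by (simp_all add: pos_le_divide_eq eq_divide_eq)
    moreover have "a * (1 - x) - b * x = a - x * (a + b)"
      by (simp add: algebra_simps)
    ultimately show "x \<le> mu_star mp \<longleftrightarrow> b * x \<le> a * (1 - x)" "x = mu_star mp \<longleftrightarrow> b * x = a * (1 - x)"
      by linarith+
  qed
  \<comment> \<open>Up to the factor \<open>j - k\<close> and a positive denominator,
    \<open>?D\<close> is the difference of the two losses.\<close>
  let ?D = "(a * (1 - k)) * (a * (1 - j)) - (b * k) * (b * j)"
  have frac: "w / x - w / y = (y - x) * (w / (x * y))" if "0 < x" "0 < y" for w x y :: real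
    using that by (simp add: field_simps)
  have minus: "(1 - j) - (1 - k) = - (j - k)"
    by simp
  have "mp / k + (1 - mp) / (1 - k) - (mp / j + (1 - mp) / (1 - j))
      = (mp / k - mp / j) + ((1 - mp) / (1 - k) - (1 - mp) / (1 - j))"
    by linarith
  also have "\<dots> = (j - k) * (mp / (k * j)) + - (j - k) * ((1 - mp) / ((1 - k) * (1 - j)))"
    using frac[of k j mp] frac[of "1 - k" "1 - j" "1 - mp"] k j unfolding minus by simp
  also have "\<dots> = (j - k) * (mp / (k * j) - (1 - mp) / ((1 - k) * (1 - j)))"
    by (simp only: mult_minus_left right_diff_distrib[of "j - k" "_ / _"] add_uminus_conv_diff)
  also have "mp / (k * j) - (1 - mp) / ((1 - k) * (1 - j)) = ?D / (k * j * ((1 - k) * (1 - j)))"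
    using k j by (subst diff_frac_eq) (simp_all add: sq(2), rule sq(1))
  finally have diff: "mp / k + (1 - mp) / (1 - k) - (mp / j + (1 - mp) / (1 - j))
      = (j - k) * ?D / (k * j * ((1 - k) * (1 - j)))"
    by simp
  have "0 \<le> (j - k) * ?D"
    using assms(7)
  proof
    assume "j = mu_star mp"
    then have j_eq: "a * (1 - j) = b * j"
      using star(2) by simp
    \<comment> \<open>This factor of \<open>?D\<close> is linear in \<open>k\<close> and vanishes at
      \<open>j\<close>, so multiplying by \<open>j - k\<close> produces a square.\<close>
    then have "a * (1 - k) - b * k = (a + b) * (j - k)"
      unfolding right_diff_distrib distrib_right by linarith
    moreover have "?D = (a * (1 - k) - b * k) * (b * j)"
      unfolding j_eq by (simp only: left_diff_distrib)
    ultimately have "(j - k) * ?D = (b * j) * ((a + b) * (j - k)\<^sup>2)"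
      by (simp only: power2_eq_square mult_ac)
    then show ?thesis
      using ab j by simp
  next
    assume "k \<le> j \<and> j \<le> mu_star mp"
    then have "k \<le> mu_star mp" "j \<le> mu_star mp" "0 \<le> j - k"
      by auto
    \<comment> \<open>Both points lie at or below the optimum, so each factor of the first product
      in \<open>?D\<close> dominates its counterpart in the second.\<close>
    then have "b * k \<le> a * (1 - k)" "b * j \<le> a * (1 - j)" "0 \<le> j - k"
      unfolding star(1) .
    then show ?thesis
      using ab k j by (intro mult_nonneg_nonneg) (auto intro!: mult_mono)
  qed
  then have "0 \<le> (j - k) * ?D / (k * j * ((1 - k) * (1 - j)))"
    using k j by (intro divide_nonneg_nonneg) simp_all
  then show ?thesis
    unfolding diff[symmetric] by simp
qed

text \<open>Two distinct signals express the richness of the signal space. Existence is included so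
  that the claim about all optimal profiles is not vacuous.\<close>

theorem proposition1:
  fixes c_hat :: "real \<Rightarrow> ereal" and lam mu_p :: real and s1 s2 :: 's
  assumes "cost_potential c_hat" and "0 < lam"
    and "s1 \<noteq> s2"
    and "1 / 2 \<le> mu_p" and "mu_p \<le> 1"
  shows "(\<exists>prof :: real \<Rightarrow> 's strategy. optimal_profile c_hat lam prof) \<and>
    (\<forall>prof :: real \<Rightarrow> 's strategy. optimal_profile c_hat lam prof \<longrightarrow>
      solves_principal mu_p prof (mu_star mu_p) \<and>
      (1 / 2 < mu_p \<and> mu_p < 1 \<longrightarrow>
        mu_star mu_p \<in> {1 / 2<..<mu_p}))"
proof -
  interpret delegation c_hat lam
    using assms by unfold_locales
  have star: "1/2 \<le> mu_star mu_p" "mu_star mu_p \<le> 1"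
    using assms mu_star_bounds by auto
  have "solves_principal mu_p prof (mu_star mu_p)"
    if opt: "optimal_profile c_hat lam prof" for prof :: "real \<Rightarrow> 's strategy"
  proof -
    have "principal_value mu_p (prof m) \<le> principal_value mu_p (prof (mu_star mu_p))"
      if m: "m \<in> {0..1}" for m
    proof -
      let ?j = "clamp_prior (mu_star mu_p)" and ?k = "clamp_prior m"
      \<comment> \<open>Since \<open>mu_star mu_p\<close> is at least 1/2, clamping can only lower
        it, to \<open>q\<close>; in that case \<open>?k\<close> is at most \<open>?j\<close>, which
        is the second alternative of \<open>harmonic_loss_min\<close>.\<close>
      have "mu_p / ?j + (1 - mu_p) / (1 - ?j) \<le> mu_p / ?k + (1 - mu_p) / (1 - ?k)"
        using assms(4,5) by (rule harmonic_loss_min) (use q star in \<open>auto simp: clamp_prior_def\<close>)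
      then show ?thesis
        using q star m
        by (simp add: principal_value_optimal[OF opt assms(3)] mult_left_mono divide_right_mono)
    qed
    then show ?thesis
      using star unfolding solves_principal_def is_arg_max_def by (auto simp: not_less)
  qed
  then show ?thesis
    using optimal_profile_exists[OF assms(3)] mu_star_between by blast
qed

end
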